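(* Let $M$ be a Heyting module over a Heyting algebra $H$. If $H$ is a Boolean algebra, then there is a one-one correspondence between hereditary systems of submodules of $M$ and hereditary submodules of $M$.
   Context: Lattices have all finite meets and joins (hence a least element $0$ and a greatest element $1$). A join semilattice is a poset in which every finite subset, including the empty one, has a join; its least element is $0$. For a distributive lattice $L$, a distributive module over $L$ is a join semilattice $M$ with an action $L\times M\to M$, $(x,m)\mapsto x\wedge m$, order preserving in both variables, such that $1\wedge m=m$, $0\wedge m=0$, $(x\wedge y)\wedge m=x\wedge(y\wedge m)$, $(x\vee y)\wedge m=(x\wedge m)\vee(y\wedge m)$, $x\wedge(m\vee n)=(x\wedge m)\vee(x\wedge n)$. A Heyting algebra $H$ is a lattice (automatically distributive) such that for all $y,z\in H$ there is $(y\to z)_H\in H$ with $x\wedge y\le z\Leftrightarrow x\le (y\to z)_H$ for all $x\in H$. A Boolean algebra is a distributive lattice in which every element has a complement. A Heyting module over $H$ is a distributive module $M$ over the lattice underlying $H$ such that for all $m,n\in M$ there is $(m\to n)_M\in H$ with $x\wedge m\le n\Leftrightarrow x\le(m\to n)_M$ for all $x\in H$. A hereditary submodule of $M$ is a sub-join-semilattice $N\subseteq M$ (closed under finite joins, containing $0$) such that $n\in N$ and $n'\le n$ imply $n'\in N$. For a hereditary submodule $K\subseteq M$ and $c\in H$ set $(K:c):=\{m\in M : c\wedge m\in K\}$, again a hereditary submodule. A hereditary system of submodules of $M$ is a family $\mathcal K=\{K_c\}_{c\in H}$ of hereditary submodules of $M$ such that for all $c,d\in H$: $K_c\cap K_d=K_{c\wedge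 d}$ and $(K_d:c)=K_{(c\to d)_H}$. *)

theory Defs imports Main begin

class heyting_algebra = bounded_lattice +
  fixes himp :: "'a \<Rightarrow> 'a \<Rightarrow> 'a"
  assumes himp_residual: "inf x y \<le> z \<longleftrightarrow> x \<le> himp y z"
begin

subclass distrib_lattice
proof
  fix x y z :: 'a
  let ?r = "inf (sup x y) (sup x z)"
  have "sup x y \<le> himp (sup x z) (sup x (inf y z))"
  proof (rule sup_least)
    show "x \<le> himp (sup x z) (sup x (inf y z))"
      by (simp add: himp_residual [symmetric] le_infI1)
    have "sup x z \<le> himp y (sup x (inf y z))"
      by (rule sup_least)
        (simp_all add: himp_residual [symmetric] le_infI1 inf_commute)
    then show "y \<le> himp (sup x z) (sup x (inf y z))"
      by (simp add: himp_residual [symmetric] inf_commute)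
  qed
  then have "?r \<le> sup x (inf y z)"
    by (simp add: himp_residual [symmetric])
  then show "sup x (inf y z) = ?r"
    by (intro order.antisym distrib_sup_le)
qed

end

locale distributive_module =
  fixes act :: "'h::{distrib_lattice, bounded_lattice} \<Rightarrow> 'm::bounded_semilattice_sup_bot \<Rightarrow> 'm"
  assumes act_mono: "x \<le> y \<Longrightarrow> m \<le> n \<Longrightarrow> act x m \<le> act y n"
    and act_top: "act top m = m"
    and act_bot: "act bot m = bot"
    and act_inf: "act (inf x y) m = act x (act y m)"
    and act_sup_left: "act (sup x y) m = sup (act x m) (act y m)"
    and act_sup_right: "act x (sup m n) = sup (act x m) (act x n)"

locale heyting_module = distributive_module act
  for act :: "'h::heyting_algebra \<Rightarrow> 'm::bounded_semilattice_sup_bot \<Rightarrow> 'm" +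
  assumes residual_exists: "\<exists>r. \<forall>x. act x m \<le> n \<longleftrightarrow> x \<le> r"

definition hereditary_submodule :: "'m::bounded_semilattice_sup_bot set \<Rightarrow> bool" where
  "hereditary_submodule N \<longleftrightarrow>
     bot \<in> N \<and> (\<forall>m\<in>N. \<forall>n\<in>N. sup m n \<in> N) \<and> (\<forall>n\<in>N. \<forall>n'. n' \<le> n \<longrightarrow> n' \<in> N)"

text \<open>\<open>colon act K c\<close> is the submodule written $(K : c)$.\<close>

definition colon :: "('h \<Rightarrow> 'm \<Rightarrow> 'm) \<Rightarrow> 'm set \<Rightarrow> 'h \<Rightarrow> 'm set" where
  "colon act K c = {m. act c m \<in> K}"

definition hereditary_system ::
    "('h::heyting_algebra \<Rightarrow> 'm::bounded_semilattice_sup_bot \<Rightarrow> 'm) \<Rightarrow> ('h \<Rightarrow> 'm set) \<Rightarrow> bool" where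
  "hereditary_system act K \<longleftrightarrow>
     (\<forall>c. hereditary_submodule (K c)) \<and>
     (\<forall>c d. K c \<inter> K d = K (inf c d)) \<and>
     (\<forall>c d. colon act (K d) c = K (himp c d))"

end

theory Submission imports Defs begin

text \<open>Over a Boolean algebra \<open>c\<close> equals \<open>himp (- c) bot\<close>, so the system axioms force
  \<open>K c = colon act (K bot) (- c)\<close>; conversely, for every hereditary submodule \<open>N\<close>, the family
  \<open>c \<mapsto> colon act N (- c)\<close> is a hereditary system with value \<open>N\<close> at \<open>bot\<close>.\<close>

text \<open>The two classes share only the lattice structure, so \<open>himp\<close> and
  \<open>-\<close> are linked by residuation alone: Boolean shunting makes
  \<open>sup (- c) d\<close> a residual too, and residuals are unique.\<close>

lemma himp_eq_sup_uminus:
  fixes c d :: "'h::{heyting_algebra, boolean_algebra}"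
  shows "himp c d = sup (- c) d"
proof (rule order.antisym)
  have "inf (himp c d) c \<le> d"
    by (simp add: himp_residual)
  then show "himp c d \<le> sup (- c) d"
    by (metis double_compl shunt1 sup_commute)
  show "sup (- c) d \<le> himp c d"
    by (simp add: himp_residual [symmetric] inf_sup_distrib2)
qed

lemma hereditary_submodule_sup_iff:
  assumes "hereditary_submodule N"
  shows "sup m n \<in> N \<longleftrightarrow> m \<in> N \<and> n \<in> N"
  using assms unfolding hereditary_submodule_def by (meson sup_ge1 sup_ge2)

context distributive_module
begin

text \<open>The axioms cover binary joins in the module; the empty join is handled by bounding
  \<open>x\<close> by \<open>top\<close>, which fixes \<open>bot\<close>.\<close>

lemma act_bot_right: "act x bot = bot"
  using act_mono [of x top bot bot] by (simp add: act_top bot_unique)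

lemma colon_top: "colon act N top = N"
  by (simp add: colon_def act_top)

lemma colon_colon: "colon act (colon act N d) c = colon act N (inf d c)"
  by (simp add: colon_def act_inf)

text \<open>The action turns \<open>sup c d\<close> into a join, and closure under joins and
  downward closure together put a join in \<open>N\<close> exactly when both parts are
  there.\<close>

lemma colon_sup:
  assumes "hereditary_submodule N"
  shows "colon act N (sup c d) = colon act N c \<inter> colon act N d"
  by (auto simp: colon_def act_sup_left hereditary_submodule_sup_iff [OF assms])

lemma hereditary_submodule_colon:
  assumes "hereditary_submodule N"
  shows "hereditary_submodule (colon act N c)"
  using assms act_mono [of c c]
  unfolding hereditary_submodule_def colon_def
  by (auto simp: act_bot_right act_sup_right)

end

lemma hereditary_system_colon_uminus:
  fixes act :: "'h::{heyting_algebra, boolean_algebra} \<Rightarrow> 'm::bounded_semilattice_sup_bot \<Rightarrow> 'm"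
  assumes "distributive_module act" and N: "hereditary_submodule N"
  shows "hereditary_system act (\<lambda>c. colon act N (- c))"
proof -
  interpret distributive_module act by fact
  show ?thesis
    \<comment> \<open>De Morgan reduces both axioms: \<open>- inf c d\<close> is
      \<open>sup (- c) (- d)\<close>, matching \<open>colon_sup\<close>, and
      \<open>- himp c d\<close> is \<open>inf c (- d)\<close>, matching
      \<open>colon_colon\<close>.\<close>
    by (simp add: hereditary_system_def hereditary_submodule_colon [OF N] colon_sup [OF N]
        colon_colon himp_eq_sup_uminus inf_commute)
qed

lemma hereditary_system_eq_colon:
  fixes act :: "'h::{heyting_algebra, boolean_algebra} \<Rightarrow> 'm::bounded_semilattice_sup_bot \<Rightarrow> 'm"
  assumes "hereditary_system act K"
  shows "K c = colon act (K bot) (- c)"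
  using assms by (simp add: hereditary_system_def himp_eq_sup_uminus)

theorem proposition4p6:
  fixes act :: "'h::{heyting_algebra, boolean_algebra} \<Rightarrow> 'm::bounded_semilattice_sup_bot \<Rightarrow> 'm"
  assumes "heyting_module act"
  shows "bij_betw (\<lambda>K. K bot) {K. hereditary_system act K} {N. hereditary_submodule N}"
proof (rule bij_betw_byWitness [where f' = "\<lambda>N c. colon act N (- c)"])
  interpret heyting_module act by fact
  show "\<forall>K\<in>{K. hereditary_system act K}. (\<lambda>c. colon act (K bot) (- c)) = K"
    using hereditary_system_eq_colon [of act] by fastforce
  \<comment> \<open>Here \<open>- bot\<close> is \<open>top\<close>, which acts as the
    identity.\<close>
  show "\<forall>N\<in>{N. hereditary_submodule N}. colon act N (- bot) = N"
    by (simp add: colon_top)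
  show "(\<lambda>K. K bot) ` {K. hereditary_system act K} \<subseteq> {N. hereditary_submodule N}"
    by (auto simp: hereditary_system_def)
  show "(\<lambda>N c. colon act N (- c)) ` {N. hereditary_submodule N} \<subseteq> {K. hereditary_system act K}"
    using hereditary_system_colon_uminus [OF distributive_module_axioms] by auto
qed

end
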